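(* Let $H$ be a $\{1,2,3\}$-graph on a finite vertex set $[n]$. Suppose that the order of a maximum complete $\{1,2,3\}$-subgraph of $H$ equals $t$ and the order of a maximum complete $\{1\}$-subgraph of $H$ also equals $t$, where $t\ge 8$. Then $$\lambda'(H)=\lambda'\left(K_t^{\{1,2,3\}}\right)=1+\frac{t-1}{t}+\frac{(t-1)(t-2)}{t^2}.$$
   Context: A hypergraph $H=(V,E)$ has edges that are subsets of $V$; its set of edge types is $R(H)=\{|F|:F\in E\}$, and $H$ is called an $R$-graph if $R(H)=R$. For $j\in R(H)$, $H^j$ denotes the set of edges of $H$ of cardinality $j$. The complete hypergraph $K_t^{R}$ has vertex set $[t]$ and edge set $\bigcup_{i\in R}\binom{[t]}{i}$. A complete $R$-subgraph of $H$ of order $t$ is a set of $t$ vertices all of whose subsets with cardinality in $R$ are edges of $H$; the order of a maximum complete $\{1\}$-subgraph is the number of $1$-edges. For $H$ with vertex set $[n]$ and $\vec x\in\mathbb{R}^n$, define $\lambda'(H,\vec x)=\sum_{j\in R(H)} j!\sum_{i_1i_2\ldots i_j\in H^j}x_{i_1}x_{i_2}\cdots x_{i_j}$, and $\lambda'(H)=\max\{\lambda'(H,\vec x): \vec x\in S\}$, where $S=\{\vec x\in\mathbb{R}^n:\sum_{i=1}^n x_i=1,\ x_i\ge 0\}$. *)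

theory Defs
  imports Complex_Main
begin

type_synonym 'a hypergraph = "'a set \<times> 'a set set"

abbreviation verts :: "'a hypergraph \<Rightarrow> 'a set" where
  "verts H \<equiv> fst H"

abbreviation edges :: "'a hypergraph \<Rightarrow> 'a set set" where
  "edges H \<equiv> snd H"

definition is_hypergraph :: "'a hypergraph \<Rightarrow> bool" where
  "is_hypergraph H \<longleftrightarrow> (\<forall>F\<in>edges H. F \<subseteq> verts H)"

definition edge_types :: "'a hypergraph \<Rightarrow> nat set" where
  "edge_types H = {card F | F. F \<in> edges H}"

definition edges_of_size :: "'a hypergraph \<Rightarrow> nat \<Rightarrow> 'a set set" where
  "edges_of_size H j = {F \<in> edges H. card F = j}"

definition complete_hypergraph :: "nat \<Rightarrow> nat set \<Rightarrow> nat hypergraph" where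
  "complete_hypergraph t R = ({1..t}, \<Union>i\<in>R. {F. F \<subseteq> {1..t} \<and> card F = i})"

definition complete_subgraph :: "nat set \<Rightarrow> 'a hypergraph \<Rightarrow> 'a set \<Rightarrow> bool" where
  "complete_subgraph R H T \<longleftrightarrow>
     T \<subseteq> verts H \<and> (\<forall>F. F \<subseteq> T \<and> card F \<in> R \<longrightarrow> F \<in> edges H)"

text \<open>Only meaningful for a finite vertex set.\<close>

definition max_complete_order :: "nat set \<Rightarrow> 'a hypergraph \<Rightarrow> nat" where
  "max_complete_order R H = Max {card T | T. complete_subgraph R H T}"

definition lagrange_poly :: "'a hypergraph \<Rightarrow> ('a \<Rightarrow> real) \<Rightarrow> real" where
  "lagrange_poly H x =
     (\<Sum>j\<in>edge_types H. fact j * (\<Sum>F\<in>edges_of_size H j. \<Prod>i\<in>F. x i))"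

text \<open>Weight vectors are functions on the whole vertex type; their values outside the
  vertex set are unconstrained and do not enter the polynomial.\<close>

definition weight_simplex :: "'a set \<Rightarrow> ('a \<Rightarrow> real) set" where
  "weight_simplex V = {x. (\<Sum>i\<in>V. x i) = 1 \<and> (\<forall>i\<in>V. 0 \<le> x i)}"

text \<open>\<open>Greatest\<close> denotes a maximum that is attained (\<open>Max\<close> applies to finite sets only). For a
  nonempty finite vertex set it exists, by compactness of the simplex.\<close>

definition lagrangian :: "'a hypergraph \<Rightarrow> real" where
  "lagrangian H = (GREATEST m. \<exists>x\<in>weight_simplex (verts H). m = lagrange_poly H x)"

end

theory Submission
  imports Defs
begin

text \<open>The vertices carrying a \<open>1\<close>-edge form a set \<open>T\<close> of order \<open>t\<close> which must itself be the maximum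
  complete subgraph. For the upper bound, all \<open>2\<close>- and \<open>3\<close>-sets may be taken to be edges; by Newton's
  identities the polynomial is then the sum of \<open>x\<^sub>i\<close> over \<open>T\<close> plus \<open>2 - \<Sum>(4x\<^sub>i\<^sup>2 - 2x\<^sub>i\<^sup>3)\<close>, the last sum
  ranging over all vertices. Vertices outside \<open>T\<close> contribute nonpositively, and on \<open>T\<close> the function
  \<open>h(x) = x - 4x\<^sup>2 + 2x\<^sup>3\<close> lies below its tangent at \<open>1/t\<close>. The slope \<open>1 - 8/t + 6/t\<^sup>2\<close> of that
  tangent is nonnegative because \<open>t \<ge> 8\<close>, so moving weight out of \<open>T\<close> never helps.\<close>

section \<open>Elementary symmetric polynomials and power sums\<close>

definition elem_sym :: "nat \<Rightarrow> 'a set \<Rightarrow> ('a \<Rightarrow> real) \<Rightarrow> real" where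
  "elem_sym k V x = (\<Sum>F | F \<subseteq> V \<and> card F = k. \<Prod>i\<in>F. x i)"

lemma elem_sym_0:
  assumes "finite V"
  shows "elem_sym 0 V x = 1"
proof -
  \<comment> \<open>Infinite sets also have \<open>card\<close> 0; finiteness of \<open>V\<close>
    rules them out.\<close>
  have "{F. F \<subseteq> V \<and> card F = 0} = {{}}"
    using assms by (auto dest: finite_subset)
  then show ?thesis by (simp add: elem_sym_def)
qed

lemma elem_sym_Suc_empty: "elem_sym (Suc k) {} x = 0"
proof -
  have "{F. F \<subseteq> {} \<and> card F = Suc k} = {}" by auto
  then show ?thesis unfolding elem_sym_def by simp
qed

text \<open>Pascal's rule: sort the subsets by whether they contain \<open>a\<close>. This drives
  the inductions on \<open>V\<close> below.\<close>

lemma elem_sym_Suc_insert: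
  assumes "finite V" "a \<notin> V"
  shows "elem_sym (Suc k) (insert a V) x = elem_sym (Suc k) V x + x a * elem_sym k V x"
proof -
  let ?A = "{F. F \<subseteq> V \<and> card F = Suc k}" and ?B = "{F. F \<subseteq> V \<and> card F = k}"
  have split: "{F. F \<subseteq> insert a V \<and> card F = Suc k} = ?A \<union> insert a ` ?B" (is "?L = ?R")
  proof
    show "?L \<subseteq> ?R"
    proof
      fix F assume F: "F \<in> ?L"
      show "F \<in> ?R"
      proof (cases "a \<in> F")
        case True
        have "finite F" using F assms(1) by (auto intro: finite_subset[of F "insert a V"])
        then have "F - {a} \<in> ?B" using F True by auto
        moreover have "F = insert a (F - {a})" using True by auto
        ultimately show ?thesis by blast
      qed (use F in auto)
    qed
    show "?R \<subseteq> ?L"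
    proof
      fix F assume "F \<in> ?R"
      then consider "F \<in> ?A" | G where "G \<in> ?B" "F = insert a G" by blast
      then show "F \<in> ?L"
      proof cases
        case 2
        then have "finite G" "a \<notin> G" using assms finite_subset by auto
        then show ?thesis using 2 by auto
      qed auto
    qed
  qed
  have inj: "inj_on (insert a) ?B"
    using assms(2) by (intro inj_onI) (metis (no_types, lifting) insert_ident mem_Collect_eq subsetD)
  have "elem_sym (Suc k) (insert a V) x
      = elem_sym (Suc k) V x + (\<Sum>F\<in>insert a ` ?B. \<Prod>i\<in>F. x i)"
    unfolding elem_sym_def split
    by (rule sum.union_disjoint) (use assms in auto)
  also have "(\<Sum>F\<in>insert a ` ?B. \<Prod>i\<in>F. x i) = (\<Sum>F\<in>?B. \<Prod>i\<in>insert a F. x i)"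
    by (simp add: sum.reindex[OF inj])
  also have "\<dots> = (\<Sum>F\<in>?B. x a * (\<Prod>i\<in>F. x i))"
  proof (rule sum.cong[OF refl])
    fix F assume "F \<in> ?B"
    then have "finite F" "a \<notin> F" using assms finite_subset by auto
    then show "(\<Prod>i\<in>insert a F. x i) = x a * (\<Prod>i\<in>F. x i)" by simp
  qed
  finally show ?thesis by (simp add: elem_sym_def sum_distrib_left)
qed

lemma elem_sym_1:
  assumes "finite V"
  shows "elem_sym 1 V x = (\<Sum>i\<in>V. x i)"
  using assms
  by (induction V) (simp_all add: elem_sym_0 elem_sym_Suc_empty elem_sym_Suc_insert)

text \<open>The factor 2 here, like the 6 for triples, is the factorial that weights these edges in
  \<open>lagrange_poly\<close>.\<close>

lemma elem_sym_2:
  assumes "finite V"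
  shows "2 * elem_sym 2 V x = (\<Sum>i\<in>V. x i)\<^sup>2 - (\<Sum>i\<in>V. (x i)\<^sup>2)"
  using assms
proof (induction V)
  case empty
  show ?case by (simp add: elem_sym_Suc_empty numeral_2_eq_2)
next
  case (insert a V)
  have "elem_sym 2 (insert a V) x = elem_sym 2 V x + x a * (\<Sum>i\<in>V. x i)"
    using elem_sym_Suc_insert[OF insert.hyps(1,2), of 1 x] elem_sym_1[OF insert.hyps(1), of x]
    by (simp add: numeral_2_eq_2)
  then show ?case using insert by (simp add: power2_eq_square algebra_simps)
qed

lemma elem_sym_3:
  assumes "finite V"
  shows "6 * elem_sym 3 V x
    = (\<Sum>i\<in>V. x i) ^ 3 - 3 * (\<Sum>i\<in>V. x i) * (\<Sum>i\<in>V. (x i)\<^sup>2) + 2 * (\<Sum>i\<in>V. x i ^ 3)"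
  using assms
proof (induction V)
  case empty
  show ?case by (simp add: elem_sym_Suc_empty numeral_3_eq_3)
next
  case (insert a V)
  have "elem_sym 3 (insert a V) x = elem_sym 3 V x + x a * elem_sym 2 V x"
    using elem_sym_Suc_insert[OF insert.hyps(1,2), of 2 x] by (simp add: eval_nat_numeral)
  then have "6 * elem_sym 3 (insert a V) x = 6 * elem_sym 3 V x + 3 * x a * (2 * elem_sym 2 V x)"
    by simp
  then show ?case unfolding insert.IH elem_sym_2[OF insert.hyps(1)]
    using insert.hyps by (simp add: power2_eq_square power3_eq_cube algebra_simps)
qed

section \<open>Upper bound on the simplex\<close>

text \<open>The cubic is convex beyond 2/3, so concavity alone does not give this on the whole unit
  interval. Instead, tangent minus cubic has a double root at \<open>a\<close>, and the remaining
  linear factor \<open>4 - 2 * x - 4 * a\<close> is at least 3/2.\<close>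

lemma tangent_bound:
  fixes x a :: real
  assumes "0 \<le> x" "x \<le> 1" "0 \<le> a" "a \<le> 1/8"
  shows "x - 4 * x\<^sup>2 + 2 * x ^ 3 \<le> (a - 4 * a\<^sup>2 + 2 * a ^ 3) + (1 - 8 * a + 6 * a\<^sup>2) * (x - a)"
proof -
  have "(x - a)\<^sup>2 * (4 - 2 * x - 4 * a) \<ge> 0" using assms by (intro mult_nonneg_nonneg) auto
  moreover have "(a - 4 * a\<^sup>2 + 2 * a ^ 3) + (1 - 8 * a + 6 * a\<^sup>2) * (x - a)
      - (x - 4 * x\<^sup>2 + 2 * x ^ 3) = (x - a)\<^sup>2 * (4 - 2 * x - 4 * a)"
    by (simp add: power2_eq_square power3_eq_cube algebra_simps)
  ultimately show ?thesis by linarith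
qed

lemma tangent_slope_nonneg:
  fixes t :: nat
  assumes "t \<ge> 8"
  shows "1 - 8 * (1 / real t) + 6 * (1 / real t)\<^sup>2 \<ge> 0"
proof -
  have "8 * (1 / real t) \<le> 1" using assms by (simp add: field_simps)
  moreover have "6 * (1 / real t)\<^sup>2 \<ge> 0" by simp
  ultimately show ?thesis by linarith
qed

lemma simplex_bound:
  fixes x :: "'a \<Rightarrow> real"
  assumes "finite V" "T \<subseteq> V" "card T = t" "t \<ge> 8" "x \<in> weight_simplex V"
  shows "(\<Sum>i\<in>T. x i) + 2 * elem_sym 2 V x + 6 * elem_sym 3 V x
    \<le> 1 + (real t - 1) / real t + (real t - 1) * (real t - 2) / (real t)\<^sup>2"
proof -
  define a where "a = 1 / real t"
  define slope where "slope = 1 - 8 * a + 6 * a\<^sup>2"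
  have sum1: "(\<Sum>i\<in>V. x i) = 1" and nonneg: "\<And>i. i \<in> V \<Longrightarrow> 0 \<le> x i"
    using assms by (auto simp: weight_simplex_def)
  have le1: "x i \<le> 1" if "i \<in> V" for i
    using member_le_sum[of i V x] that nonneg assms(1) sum1 by simp
  have a: "0 \<le> a" "a \<le> 1/8" "real t * a = 1" using assms(4) by (auto simp: a_def field_simps)
  have slope: "slope \<ge> 0" using tangent_slope_nonneg[OF assms(4)] by (simp add: slope_def a_def)
  let ?q = "\<lambda>i. 4 * (x i)\<^sup>2 - 2 * x i ^ 3"
  have q: "?q i \<ge> 0" if "i \<in> V" for i
  proof -
    have "?q i = 2 * (x i)\<^sup>2 * (2 - x i)" by (simp add: power2_eq_square power3_eq_cube algebra_simps)
    then show ?thesis using le1[OF that] by simp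
  qed
  have T1: "(\<Sum>i\<in>T. x i) \<le> 1"
    using sum_mono2[OF assms(1,2), of x] nonneg sum1 by auto
  \<comment> \<open>With total weight 1 and power sums p2, p3, the two terms are 1 - p2 and 1 - 3 p2
    + 2 p3.\<close>
  have "2 * elem_sym 2 V x + 6 * elem_sym 3 V x = 2 - (\<Sum>i\<in>V. ?q i)"
    by (simp add: elem_sym_2[OF assms(1)] elem_sym_3[OF assms(1)] sum1 sum_subtractf
        flip: sum_distrib_left)
  moreover have "(\<Sum>i\<in>T. ?q i) \<le> (\<Sum>i\<in>V. ?q i)"
    using q by (intro sum_mono2[OF assms(1,2)]) auto
  moreover have "(\<Sum>i\<in>T. x i - ?q i)
      \<le> (\<Sum>i\<in>T. (a - 4 * a\<^sup>2 + 2 * a ^ 3) + slope * (x i - a))"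
  proof (rule sum_mono)
    fix i assume "i \<in> T"
    then have "i \<in> V" using assms(2) by auto
    from tangent_bound[OF nonneg[OF this] le1[OF this] a(1,2)]
    show "x i - ?q i \<le> (a - 4 * a\<^sup>2 + 2 * a ^ 3) + slope * (x i - a)"
      by (simp add: slope_def)
  qed
  moreover have "\<dots> = real t * (a - 4 * a\<^sup>2 + 2 * a ^ 3) + slope * ((\<Sum>i\<in>T. x i) - real t * a)"
    by (simp add: sum.distrib sum_subtractf assms(3) flip: sum_distrib_left)
  \<comment> \<open>The tangent point was chosen so that \<open>real t * a = 1\<close>, while the
    weight on \<open>T\<close> is at most 1.\<close>
  moreover have "slope * ((\<Sum>i\<in>T. x i) - real t * a) \<le> 0"
    using slope T1 a(3) by (intro mult_nonneg_nonpos) auto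
  moreover have "(\<Sum>i\<in>T. x i - ?q i) = (\<Sum>i\<in>T. x i) - (\<Sum>i\<in>T. ?q i)"
    by (rule sum_subtractf)
  moreover have "real t * (a - 4 * a\<^sup>2 + 2 * a ^ 3) + 2
      = 1 + (real t - 1) / real t + (real t - 1) * (real t - 2) / (real t)\<^sup>2"
    using assms(4) by (simp add: a_def field_simps power2_eq_square power3_eq_cube)
  ultimately show ?thesis by linarith
qed

section \<open>Evaluating the Lagrangian\<close>

lemma lagrange_poly_123:
  assumes "edge_types H = {1, 2, 3}"
  shows "lagrange_poly H x = (\<Sum>F\<in>edges_of_size H 1. \<Prod>i\<in>F. x i)
    + 2 * (\<Sum>F\<in>edges_of_size H 2. \<Prod>i\<in>F. x i) + 6 * (\<Sum>F\<in>edges_of_size H 3. \<Prod>i\<in>F. x i)"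
  by (simp add: lagrange_poly_def assms fact_numeral)

text \<open>Stated so as to cover both \<open>H\<close> and the complete hypergraph: the bound on
  the simplex is met by the uniform weight on \<open>T\<close>.\<close>

lemma lagrangian_eq_if_singletons_complete:
  fixes H :: "'a hypergraph"
  assumes H: "is_hypergraph H" "finite (verts H)" "edge_types H = {1, 2, 3}"
    and T: "complete_subgraph {1, 2, 3} H T" "\<And>i. {i} \<in> edges H \<longleftrightarrow> i \<in> T"
    and t: "card T = t" "t \<ge> 8"
  shows "lagrangian H = 1 + (real t - 1) / real t + (real t - 1) * (real t - 2) / (real t)\<^sup>2"
    (is "_ = ?m")
proof -
  let ?V = "verts H"
  have TV: "T \<subseteq> ?V" using T(1) by (simp add: complete_subgraph_def)
  have finT: "finite T" using TV H(2) finite_subset by blast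
  have size1: "edges_of_size H 1 = (\<lambda>i. {i}) ` T"
    using T(2) by (auto simp: edges_of_size_def card_1_singleton_iff)
  have sum1: "(\<Sum>F\<in>edges_of_size H 1. \<Prod>i\<in>F. x i) = (\<Sum>i\<in>T. x i)" for x :: "'a \<Rightarrow> real"
    unfolding size1 by (subst sum.reindex) auto
  have sub: "edges_of_size H j \<subseteq> {F. F \<subseteq> ?V \<and> card F = j}" for j
    using H(1) by (auto simp: edges_of_size_def is_hypergraph_def)
  have fin: "finite {F. F \<subseteq> ?V \<and> card F = j}" for j
    using H(2) by simp
  have upper: "lagrange_poly H x \<le> ?m" if x: "x \<in> weight_simplex ?V" for x
  proof -
    \<comment> \<open>Missing edges only add nonnegative products. This is applied to sizes 2 and 3
      only; the 1-edges are kept exact by \<open>sum1\<close>.\<close>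
    have "(\<Sum>F\<in>edges_of_size H j. \<Prod>i\<in>F. x i) \<le> elem_sym j ?V x" for j
      unfolding elem_sym_def
      by (intro sum_mono2 fin sub prod_nonneg) (use x in \<open>auto simp: weight_simplex_def\<close>)
    from this[of 2] this[of 3] show ?thesis
      using simplex_bound[OF H(2) TV t x] unfolding lagrange_poly_123[OF H(3)] sum1 by linarith
  qed
  \<comment> \<open>All tangent inequalities are equalities at weight \<open>1 / real t\<close>, and
    vertices outside \<open>T\<close> must carry no weight.\<close>
  define y where "y = (\<lambda>i. if i \<in> T then 1 / real t else 0)"
  have ysum: "(\<Sum>i\<in>T. y i ^ k) = real t * (1 / real t) ^ k" for k
    using t(1) by (simp add: y_def)
  have "(\<Sum>i\<in>?V. y i) = (\<Sum>i\<in>T. y i)"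
    by (rule sum.mono_neutral_right[OF H(2) TV]) (simp add: y_def)
  also have yT: "\<dots> = 1" using ysum[of 1] t by simp
  finally have y: "y \<in> weight_simplex ?V" by (simp add: weight_simplex_def y_def)
  have "?m = (\<Sum>i\<in>T. y i) + 2 * elem_sym 2 T y + 6 * elem_sym 3 T y"
    unfolding elem_sym_2[OF finT] elem_sym_3[OF finT] yT ysum using t(2)
    by (simp add: field_simps power2_eq_square power3_eq_cube)
  also have "\<dots> \<le> lagrange_poly H y"
  proof -
    \<comment> \<open>Completeness makes every \<open>j\<close>-subset of \<open>T\<close> an edge;
      any further edges contribute nonnegatively.\<close>
    have "elem_sym j T y \<le> (\<Sum>F\<in>edges_of_size H j. \<Prod>i\<in>F. y i)" if "j \<in> {1, 2, 3}" for j
      unfolding elem_sym_def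
    proof (intro sum_mono2 prod_nonneg)
      show "finite (edges_of_size H j)" by (rule finite_subset[OF sub fin])
      show "{F. F \<subseteq> T \<and> card F = j} \<subseteq> edges_of_size H j"
        using T(1) that by (auto simp: edges_of_size_def complete_subgraph_def)
    qed (simp add: y_def)
    from this[of 2] this[of 3] show ?thesis unfolding lagrange_poly_123[OF H(3)] sum1 by simp
  qed
  finally have "lagrange_poly H y = ?m" using upper[OF y] by simp
  then show ?thesis
    unfolding lagrangian_def by (intro Greatest_equality) (use y upper in force)+
qed

section \<open>Maximum complete subgraphs and the conclusion\<close>

text \<open>The orders form a finite set because \<open>verts H\<close> has finitely many subsets,
  and \<open>K\<close> makes it nonempty, so \<open>Max\<close> is attained.\<close>

lemma
  assumes "finite (verts H)" "complete_subgraph R H K"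
  shows max_complete_order_attained:
      "\<exists>T. complete_subgraph R H T \<and> card T = max_complete_order R H"
      (is ?attained)
    and card_le_max_complete_order:
      "card K \<le> max_complete_order R H"
proof -
  let ?C = "{card T | T. complete_subgraph R H T}"
  have "?C \<subseteq> card ` Pow (verts H)" by (auto simp: complete_subgraph_def)
  then have fin: "finite ?C" by (rule finite_subset) (use assms in simp)
  show ?attained
    using Max_in[OF fin] assms(2) unfolding max_complete_order_def by fastforce
  show "card K \<le> max_complete_order R H"
    unfolding max_complete_order_def by (rule Max_ge[OF fin]) (use assms(2) in blast)
qed

lemma lagrangian_complete_hypergraph_123:
  assumes "t \<ge> 8"
  shows "lagrangian (complete_hypergraph t {1, 2, 3})
    = 1 + (real t - 1) / real t + (real t - 1) * (real t - 2) / (real t)\<^sup>2"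
proof (rule lagrangian_eq_if_singletons_complete[where T = "{1..t}"])
  let ?K = "complete_hypergraph t {1, 2, 3}"
  show "is_hypergraph ?K" by (auto simp: is_hypergraph_def complete_hypergraph_def)
  show "edge_types ?K = {1, 2, 3}"
  proof
    show "edge_types ?K \<subseteq> {1, 2, 3}" by (auto simp: edge_types_def complete_hypergraph_def)
    show "{1, 2, 3} \<subseteq> edge_types ?K"
    proof
      fix j :: nat assume j: "j \<in> {1, 2, 3}"
      \<comment> \<open>A witness of each size fits because \<open>j\<close> is at most 3 and
        \<open>t\<close> at least 8.\<close>
      then have "{1..j} \<in> edges ?K" using assms by (auto simp: complete_hypergraph_def)
      moreover have "j = card {1..j}" by simp
      ultimately show "j \<in> edge_types ?K" unfolding edge_types_def by blast
    qed
  qed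
qed (use assms in \<open>auto simp: complete_hypergraph_def complete_subgraph_def\<close>)

theorem theorem5p2:
  fixes H :: "nat hypergraph" and n t :: nat
  assumes "is_hypergraph H"
    and "verts H = {1..n}"
    and "edge_types H = {1, 2, 3}"
    and "max_complete_order {1, 2, 3} H = t"
    and "max_complete_order {1} H = t"
    and "t \<ge> 8"
  shows "lagrangian H = lagrangian (complete_hypergraph t {1, 2, 3}) \<and>
         lagrangian (complete_hypergraph t {1, 2, 3}) =
           1 + (real t - 1) / real t + (real t - 1) * (real t - 2) / (real t)\<^sup>2"
proof -
  have fin: "finite (verts H)" using assms(2) by simp
  define T where "T = {i. {i} \<in> edges H}"
  have TV: "T \<subseteq> verts H" using assms(1) by (auto simp: T_def is_hypergraph_def)
  have T1: "complete_subgraph {1} H T"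
    using TV by (auto simp: T_def complete_subgraph_def card_1_singleton_iff)
  \<comment> \<open>Its only subset has size 0, so completeness is vacuous; this provides the
    nonempty family for the maximum.\<close>
  have "complete_subgraph {1, 2, 3} H {}" by (simp add: complete_subgraph_def)
  then obtain K where K: "complete_subgraph {1, 2, 3} H K" "card K = t"
    using max_complete_order_attained[OF fin] assms(4) by metis
  \<comment> \<open>Each vertex of \<open>K\<close> carries a 1-edge. Since \<open>T\<close> is a
    complete {1}-subgraph, it has at most \<open>t = card K\<close> elements, which forces
    equality.\<close>
  have "K \<subseteq> T" using K(1) by (auto simp: T_def complete_subgraph_def)
  moreover have "card T \<le> t"
    using card_le_max_complete_order[OF fin T1] assms(5) by simp
  ultimately have "K = T"
    using card_seteq[of T K] finite_subset[OF TV fin] K(2) by simp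
  then have "lagrangian H
      = 1 + (real t - 1) / real t + (real t - 1) * (real t - 2) / (real t)\<^sup>2"
    using K assms(6)
    by (intro lagrangian_eq_if_singletons_complete[OF assms(1) fin assms(3)]) (auto simp: T_def)
  then show ?thesis using lagrangian_complete_hypergraph_123[OF assms(6)] by simp
qed

end
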